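(* For every integer $n \geq 2$, the enhanced power graph $\mathcal{P}_e(SD_{8n})$ of the semidihedral group $SD_{8n}$ is perfect.
   Context: For $n \geq 2$, $SD_{8n} = \langle a, b : a^{4n} = b^2 = e,\ ba = a^{2n-1}b \rangle$ is the semidihedral group of order $8n$. The enhanced power graph $\mathcal{P}_e(G)$ of a group $G$ is the simple undirected graph with vertex set $G$ in which two distinct vertices are adjacent if and only if they belong to a common cyclic subgroup of $G$. A graph $\Gamma$ is perfect if for every induced subgraph $\Gamma'$ of $\Gamma$ the clique number $\omega(\Gamma')$ equals the chromatic number $\chi(\Gamma')$. *)

theory Defs
  imports "HOL-Algebra.Algebra"
begin

section \<open>Groups given by generators and relations\<close>

text \<open>
  A word is a list of generators and formal inverses of generators. Two words are identified
  when they are related by the congruence generated by free cancellation and by the pairs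
  (u, v) in R, which stand for the defining relations u = v. The quotient is the group
  presented by the generators of type 'x and the relations R.
\<close>

datatype 'x letter = Gen 'x | GenInv 'x

inductive word_eq ::
  "('x letter list \<times> 'x letter list) set \<Rightarrow> 'x letter list \<Rightarrow> 'x letter list \<Rightarrow> bool"
  for R where
  relation: "(u, v) \<in> R \<Longrightarrow> word_eq R u v"
| cancel_right: "word_eq R [Gen x, GenInv x] []"
| cancel_left: "word_eq R [GenInv x, Gen x] []"
| refl: "word_eq R u u"
| sym: "word_eq R u v \<Longrightarrow> word_eq R v u"
| trans: "word_eq R u v \<Longrightarrow> word_eq R v w \<Longrightarrow> word_eq R u w"
| cong: "word_eq R u v \<Longrightarrow> word_eq R u' v' \<Longrightarrow> word_eq R (u @ u') (v @ v')"

definition word_class ::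
  "('x letter list \<times> 'x letter list) set \<Rightarrow> 'x letter list \<Rightarrow> 'x letter list set" where
  "word_class R u = {v. word_eq R u v}"

definition presented_group ::
  "('x letter list \<times> 'x letter list) set \<Rightarrow> 'x letter list set monoid" where
  "presented_group R =
     \<lparr>carrier = range (word_class R),
      monoid.mult = (\<lambda>A B. \<Union>u\<in>A. \<Union>v\<in>B. word_class R (u @ v)),
      monoid.one = word_class R []\<rparr>"

section \<open>The semidihedral group\<close>

datatype sd_gen = SD_a | SD_b

text \<open>The parameter \<open>n\<close> yields the group of order \<open>8n\<close>, see \<open>order_semidihedral_group\<close> below.\<close>

definition semidihedral_relations :: "nat \<Rightarrow> (sd_gen letter list \<times> sd_gen letter list) set" where
  "semidihedral_relations n =
     {(replicate (4 * n) (Gen SD_a), []),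
      (replicate 2 (Gen SD_b), []),
      ([Gen SD_b, Gen SD_a], replicate (2 * n - 1) (Gen SD_a) @ [Gen SD_b])}"

definition semidihedral_group :: "nat \<Rightarrow> sd_gen letter list set monoid" where
  "semidihedral_group n = presented_group (semidihedral_relations n)"

section \<open>Simple undirected graphs and perfection\<close>

text \<open>Edges are two-element sets of vertices. All notions are meant for finite graphs.\<close>

record 'a ugraph =
  verts :: "'a set"
  edges :: "'a set set"

definition induced_subgraph :: "'a ugraph \<Rightarrow> 'a set \<Rightarrow> 'a ugraph" where
  "induced_subgraph \<Gamma> W = \<lparr>verts = W, edges = {e \<in> edges \<Gamma>. e \<subseteq> W}\<rparr>"

definition clique :: "'a ugraph \<Rightarrow> 'a set \<Rightarrow> bool" where
  "clique \<Gamma> K \<longleftrightarrow> K \<subseteq> verts \<Gamma> \<and> (\<forall>x\<in>K. \<forall>y\<in>K. x \<noteq> y \<longrightarrow> {x, y} \<in> edges \<Gamma>)"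

definition clique_number :: "'a ugraph \<Rightarrow> nat" where
  "clique_number \<Gamma> = Max (card ` {K. clique \<Gamma> K})"

definition colourable :: "'a ugraph \<Rightarrow> nat \<Rightarrow> bool" where
  "colourable \<Gamma> k \<longleftrightarrow>
     (\<exists>c :: 'a \<Rightarrow> nat. c ` verts \<Gamma> \<subseteq> {..<k} \<and>
        (\<forall>x\<in>verts \<Gamma>. \<forall>y\<in>verts \<Gamma>. {x, y} \<in> edges \<Gamma> \<longrightarrow> c x \<noteq> c y))"

definition chromatic_number :: "'a ugraph \<Rightarrow> nat" where
  "chromatic_number \<Gamma> = (LEAST k. colourable \<Gamma> k)"

definition perfect_graph :: "'a ugraph \<Rightarrow> bool" where
  "perfect_graph \<Gamma> \<longleftrightarrow>
     (\<forall>W \<subseteq> verts \<Gamma>. clique_number (induced_subgraph \<Gamma> W) = chromatic_number (induced_subgraph \<Gamma> W))"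

section \<open>The enhanced power graph\<close>

definition enhanced_power_graph :: "('a, 'b) monoid_scheme \<Rightarrow> 'a ugraph" where
  "enhanced_power_graph G =
     \<lparr>verts = carrier G,
      edges = {{x, y} | x y. x \<in> carrier G \<and> y \<in> carrier G \<and> x \<noteq> y \<and>
                 (\<exists>H. subgroup H G \<and> cyclic_group (G\<lparr>carrier := H\<rparr>) \<and> x \<in> H \<and> y \<in> H)}\<rparr>"

section \<open>The presentation defines a group of order \<open>8n\<close>\<close>

lemma word_class_eq_iff: "word_class R u = word_class R v \<longleftrightarrow> word_eq R u v"
proof
  assume "word_class R u = word_class R v"
  moreover have "v \<in> word_class R v" by (simp add: word_class_def word_eq.refl)
  ultimately show "word_eq R u v" unfolding word_class_def by blast
next
  assume "word_eq R u v"
  then show "word_class R u = word_class R v"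
    unfolding word_class_def by (blast dest: word_eq.sym word_eq.trans)
qed

lemma mult_presented_group:
  "word_class R u \<otimes>\<^bsub>presented_group R\<^esub> word_class R v = word_class R (u @ v)"
proof -
  have "word_class R (u' @ v') = word_class R (u @ v)"
    if "u' \<in> word_class R u" "v' \<in> word_class R v" for u' v'
    unfolding word_class_eq_iff using that unfolding word_class_def mem_Collect_eq
    by (rule word_eq.cong[OF word_eq.sym word_eq.sym])
  then have "(\<Union>u'\<in>word_class R u. \<Union>v'\<in>word_class R v. word_class R (u' @ v')) =
      (\<Union>u'\<in>word_class R u. \<Union>v'\<in>word_class R v. word_class R (u @ v))"
    by (intro SUP_cong HOL.refl)
  moreover have "u \<in> word_class R u" "v \<in> word_class R v"
    by (simp_all add: word_class_def word_eq.refl)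
  ultimately show ?thesis
    unfolding presented_group_def monoid.simps by blast
qed

primrec inv_letter :: "'x letter \<Rightarrow> 'x letter" where
  "inv_letter (Gen x) = GenInv x"
| "inv_letter (GenInv x) = Gen x"

lemma word_eq_inverse: "word_eq R (rev (map inv_letter u) @ u) []"
proof (induction u)
  case Nil
  then show ?case by (simp add: word_eq.refl)
next
  case (Cons l u)
  have "word_eq R [inv_letter l, l] []"
    by (cases l) (auto intro: word_eq.cancel_left word_eq.cancel_right)
  from word_eq.cong[OF word_eq.refl word_eq.cong[OF this word_eq.refl]]
  have "word_eq R (rev (map inv_letter u) @ [inv_letter l, l] @ u) (rev (map inv_letter u) @ [] @ u)" .
  with Cons show ?case by (simp add: word_eq.trans)
qed

lemma group_presented_group: "group (presented_group R)"
proof (rule groupI)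
  have car: "carrier (presented_group R) = range (word_class R)"
    and one: "\<one>\<^bsub>presented_group R\<^esub> = word_class R []"
    by (simp_all add: presented_group_def)
  note [simp] = car one
  show "\<And>x y. x \<in> carrier (presented_group R) \<Longrightarrow> y \<in> carrier (presented_group R) \<Longrightarrow>
      x \<otimes>\<^bsub>presented_group R\<^esub> y \<in> carrier (presented_group R)"
    by (auto simp: mult_presented_group)
  show "\<one>\<^bsub>presented_group R\<^esub> \<in> carrier (presented_group R)" by simp
  show "\<And>x y z. x \<in> carrier (presented_group R) \<Longrightarrow> y \<in> carrier (presented_group R) \<Longrightarrow>
      z \<in> carrier (presented_group R) \<Longrightarrow>
      x \<otimes>\<^bsub>presented_group R\<^esub> y \<otimes>\<^bsub>presented_group R\<^esub> z =
      x \<otimes>\<^bsub>presented_group R\<^esub> (y \<otimes>\<^bsub>presented_group R\<^esub> z)"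
    by (auto simp: mult_presented_group)
  show "\<And>x. x \<in> carrier (presented_group R) \<Longrightarrow>
      \<one>\<^bsub>presented_group R\<^esub> \<otimes>\<^bsub>presented_group R\<^esub> x = x"
    by (auto simp: mult_presented_group)
  fix x assume "x \<in> carrier (presented_group R)"
  then obtain u where "x = word_class R u" by auto
  then show "\<exists>y\<in>carrier (presented_group R). y \<otimes>\<^bsub>presented_group R\<^esub> x = \<one>\<^bsub>presented_group R\<^esub>"
    by (auto simp: mult_presented_group word_class_eq_iff intro!: word_eq_inverse)
qed

lemma group_semidihedral_group: "group (semidihedral_group n)"
  by (simp add: semidihedral_group_def group_presented_group)

text \<open>
  The words act on pairs \<open>(i, j)\<close>, which stand for \<open>a\<^sup>ib\<^sup>j\<close>, as left multiplication does; this
  separates the \<open>8n\<close> normal forms.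
\<close>

fun sd_act :: "int \<Rightarrow> sd_gen letter \<Rightarrow> int \<times> bool \<Rightarrow> int \<times> bool" where
  "sd_act n (Gen SD_a) (i, j) = ((i + 1) mod (4 * n), j)"
| "sd_act n (GenInv SD_a) (i, j) = ((i - 1) mod (4 * n), j)"
| "sd_act n (Gen SD_b) (i, j) = ((2 * n - 1) * i mod (4 * n), \<not> j)"
| "sd_act n (GenInv SD_b) (i, j) = ((2 * n - 1) * i mod (4 * n), \<not> j)"

definition sd_states :: "int \<Rightarrow> (int \<times> bool) set" where
  "sd_states n = {0..<4 * n} \<times> UNIV"

lemma sd_act_states: "n > 0 \<Longrightarrow> p \<in> sd_states n \<Longrightarrow> foldr (sd_act n) u p \<in> sd_states n"
proof (induction u)
  case (Cons l u)
  then show ?case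
    by (cases "(n, l, foldr (sd_act n) u p)" rule: sd_act.cases) (auto simp: sd_states_def)
qed simp

lemma foldr_sd_act_a:
  assumes "n > 0" "(i, j) \<in> sd_states n"
  shows "foldr (sd_act n) (replicate k (Gen SD_a)) (i, j) = ((i + int k) mod (4 * n), j)"
  using assms by (induction k) (auto simp: sd_states_def mod_simps algebra_simps)

lemma sd_square: "(2 * n - 1) * ((2 * n - 1) * i mod (4 * n)) mod (4 * n) = i mod (4 * n :: int)"
proof -
  have "(2 * n - 1) * ((2 * n - 1) * i) = i + (4 * n) * (n * i - i)"
    by (simp add: algebra_simps)
  then show ?thesis by (simp add: mod_mult_right_eq)
qed

lemma sd_act_word_eq:
  assumes "word_eq (semidihedral_relations n) u v" "n > 0" "p \<in> sd_states (int n)"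
  shows "foldr (sd_act (int n)) u p = foldr (sd_act (int n)) v p"
  using assms
proof (induction arbitrary: p rule: word_eq.induct)
  case (relation u v)
  define N where "N = int n"
  obtain i j where p: "p = (i, j)" by force
  have i: "0 \<le> i" "i < 4 * N" and N: "N > 0" and ij: "(i, j) \<in> sd_states N"
    using relation p by (auto simp: sd_states_def N_def)
  from relation(1) consider
      "u = replicate (4 * n) (Gen SD_a)" "v = []"
    | "u = [Gen SD_b, Gen SD_b]" "v = []"
    | "u = [Gen SD_b, Gen SD_a]" "v = replicate (2 * n - 1) (Gen SD_a) @ [Gen SD_b]"
    by (auto simp: semidihedral_relations_def numeral_2_eq_2)
  then have "foldr (sd_act N) u p = foldr (sd_act N) v p"
  proof cases
    case 1
    then show ?thesis using foldr_sd_act_a[OF N ij, of "4 * n"] i by (simp add: p N_def)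
  next
    case 2
    then show ?thesis using i by (simp add: p sd_square del: mod_mult_right_eq)
  next
    case 3
    let ?i = "(2 * N - 1) * i mod (4 * N)"
    have m: "(?i, \<not> j) \<in> sd_states N"
      using N by (simp add: sd_states_def)
    have "int (2 * n - 1) = 2 * N - 1" using N by (simp add: N_def of_nat_diff)
    moreover have "(2 * N - 1) * ((i + 1) mod (4 * N)) mod (4 * N) = (?i + (2 * N - 1)) mod (4 * N)"
      unfolding mod_mult_right_eq mod_add_left_eq by (simp only: distrib_left mult_1_right)
    ultimately show ?thesis using 3 foldr_sd_act_a[OF N m, of "2 * n - 1"] by (simp add: p)
  qed
  then show ?case by (simp add: N_def)
next
  case (cancel_right x)
  then show ?case
    by (cases x; cases p) (auto simp: sd_states_def mod_add_left_eq mod_diff_left_eq sd_square simp del: mod_mult_right_eq)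
next
  case (cancel_left x)
  then show ?case
    by (cases x; cases p) (auto simp: sd_states_def mod_add_left_eq mod_diff_left_eq sd_square simp del: mod_mult_right_eq)
next
  case (cong u v u' v')
  then show ?case by (simp add: sd_act_states)
qed auto

definition sd_normal_form :: "nat \<times> bool \<Rightarrow> sd_gen letter list" where
  "sd_normal_form p = replicate (fst p) (Gen SD_a) @ (if snd p then [Gen SD_b] else [])"

lemma sd_act_normal_form:
  assumes "n > 0" "i < 4 * n"
  shows "foldr (sd_act (int n)) (sd_normal_form (i, j)) (0, False) = (int i, j)"
  using assms foldr_sd_act_a[of "int n" 0 "j" i]
  by (auto simp: sd_normal_form_def sd_states_def)

lemma sd_a_mod:
  "word_eq (semidihedral_relations n) (replicate k (Gen SD_a)) (replicate (k mod (4 * n)) (Gen SD_a))"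
proof -
  let ?E = "word_eq (semidihedral_relations n)"
  have "?E (replicate (4 * n * q + r) (Gen SD_a)) (replicate r (Gen SD_a))" for q r
  proof (induction q)
    case (Suc q)
    have "?E (replicate (4 * n) (Gen SD_a)) []"
      by (rule word_eq.relation) (simp add: semidihedral_relations_def)
    from word_eq.cong[OF this Suc] show ?case
      by (simp add: replicate_add[symmetric] add.assoc)
  qed (simp add: word_eq.refl)
  from this[of "k div (4 * n)" "k mod (4 * n)"] show ?thesis by simp
qed

lemma sd_b_a:
  "word_eq (semidihedral_relations n) (Gen SD_b # replicate k (Gen SD_a))
     (replicate ((2 * n - 1) * k) (Gen SD_a) @ [Gen SD_b])"
proof (induction k)
  case (Suc k)
  let ?E = "word_eq (semidihedral_relations n)"
  have "?E [Gen SD_b, Gen SD_a] (replicate (2 * n - 1) (Gen SD_a) @ [Gen SD_b])"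
    by (rule word_eq.relation) (simp add: semidihedral_relations_def)
  from word_eq.cong[OF this word_eq.refl[of _ "replicate k (Gen SD_a)"]]
  have "?E (Gen SD_b # replicate (Suc k) (Gen SD_a))
      (replicate (2 * n - 1) (Gen SD_a) @ Gen SD_b # replicate k (Gen SD_a))" by simp
  also have "?E \<dots> (replicate (2 * n - 1) (Gen SD_a) @ replicate ((2 * n - 1) * k) (Gen SD_a) @ [Gen SD_b])"
    by (rule word_eq.cong[OF word_eq.refl Suc])
  finally (word_eq.trans) show ?case
    by (simp only: mult_Suc_right replicate_add append_assoc)
qed (simp add: word_eq.refl)

lemma sd_normal_form_exists:
  assumes "n > 0"
  shows "\<exists>i j. i < 4 * n \<and> word_eq (semidihedral_relations n) u (sd_normal_form (i, j))"
proof (induction u)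
  case Nil
  show ?case using assms
    by (intro exI[of _ 0] exI[of _ False]) (simp add: sd_normal_form_def word_eq.refl)
next
  case (Cons l u)
  let ?E = "word_eq (semidihedral_relations n)"
  from Cons obtain i j where ij: "?E u (sd_normal_form (i, j))" by auto
  have bb: "?E [Gen SD_b, Gen SD_b] []"
    by (rule word_eq.relation) (simp add: semidihedral_relations_def numeral_2_eq_2)
  have a: "?E [GenInv SD_a] (replicate (4 * n - 1) (Gen SD_a))"
  proof -
    have eq: "replicate (4 * n) (Gen SD_a) = [Gen SD_a] @ replicate (4 * n - 1) (Gen SD_a)"
      using assms by (cases "4 * n") auto
    have "?E ([GenInv SD_a] @ replicate (4 * n) (Gen SD_a)) ([GenInv SD_a] @ [])"
      by (rule word_eq.cong[OF word_eq.refl word_eq.relation]) (simp add: semidihedral_relations_def)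
    from word_eq.sym[OF this]
    have "?E [GenInv SD_a] ([GenInv SD_a, Gen SD_a] @ replicate (4 * n - 1) (Gen SD_a))"
      using eq by simp
    also have "?E \<dots> ([] @ replicate (4 * n - 1) (Gen SD_a))"
      by (rule word_eq.cong[OF word_eq.cancel_left word_eq.refl])
    finally (word_eq.trans) show ?thesis by simp
  qed
  have b: "?E [GenInv SD_b] [Gen SD_b]"
  proof -
    from word_eq.cong[OF word_eq.refl[of _ "[GenInv SD_b]"] bb]
    have "?E [GenInv SD_b] ([GenInv SD_b, Gen SD_b] @ [Gen SD_b])"
      using word_eq.sym by fastforce
    also have "?E \<dots> ([] @ [Gen SD_b])"
      by (rule word_eq.cong[OF word_eq.cancel_left word_eq.refl])
    finally (word_eq.trans) show ?thesis by simp
  qed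
  obtain w where lw: "?E [l] w" and w: "w = [Gen SD_b] \<or> (\<exists>k. w = replicate k (Gen SD_a))"
  proof (cases l)
    case (Gen x)
    have "[Gen SD_a] = replicate 1 (Gen SD_a)" by simp
    then show ?thesis using that[of "[l]"] Gen word_eq.refl by (cases x) blast+
  next
    case (GenInv x)
    then show ?thesis using that a b by (cases x) blast+
  qed
  have lu: "?E (l # u) (w @ sd_normal_form (i, j))"
    using word_eq.cong[OF lw ij] by simp
  have "\<exists>k j'. ?E (w @ sd_normal_form (i, j)) (sd_normal_form (k, j'))"
    using w
  proof
    assume "\<exists>k. w = replicate k (Gen SD_a)"
    then obtain k where "w = replicate k (Gen SD_a)" ..
    then have "w @ sd_normal_form (i, j) = sd_normal_form (k + i, j)"
      by (simp add: sd_normal_form_def replicate_add)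
    then show ?thesis by (metis word_eq.refl)
  next
    assume w: "w = [Gen SD_b]"
    let ?t = "if j then [Gen SD_b] else []"
    let ?r = "replicate ((2 * n - 1) * i) (Gen SD_a)"
    have "?E (w @ sd_normal_form (i, j)) ((?r @ [Gen SD_b]) @ ?t)"
      using word_eq.cong[OF sd_b_a[of n i] word_eq.refl[of _ ?t]] w
      by (simp add: sd_normal_form_def)
    moreover have "?E (?r @ [Gen SD_b] @ ?t) (sd_normal_form ((2 * n - 1) * i, \<not> j))"
      unfolding sd_normal_form_def fst_conv snd_conv
      by (rule word_eq.cong[OF word_eq.refl]) (use bb in \<open>auto intro: word_eq.refl\<close>)
    ultimately show ?thesis by (metis append_assoc word_eq.trans)
  qed
  then obtain k j' where k: "?E (w @ sd_normal_form (i, j)) (sd_normal_form (k, j'))" by blast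
  have "?E (sd_normal_form (k, j')) (sd_normal_form (k mod (4 * n), j'))"
    unfolding sd_normal_form_def fst_conv snd_conv by (rule word_eq.cong[OF sd_a_mod word_eq.refl])
  with lu k have "?E (l # u) (sd_normal_form (k mod (4 * n), j'))" by (blast intro: word_eq.trans)
  moreover have "k mod (4 * n) < 4 * n" using assms by simp
  ultimately show ?case by blast
qed

lemma order_semidihedral_group:
  assumes "n > 0"
  shows "order (semidihedral_group n) = 8 * n"
proof -
  let ?f = "\<lambda>p. word_class (semidihedral_relations n) (sd_normal_form p)"
  have "inj_on ?f ({..<4 * n} \<times> UNIV)"
  proof (rule inj_onI, clarsimp)
    fix i j i' j'
    assume "i < 4 * n" "i' < 4 * n" "?f (i, j) = ?f (i', j')"
    moreover have "(0, False) \<in> sd_states (int n)" using assms by (simp add: sd_states_def)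
    ultimately show "i = i' \<and> j = j'"
      using sd_act_word_eq[of n "sd_normal_form (i, j)" "sd_normal_form (i', j')" "(0, False)"]
        sd_act_normal_form[OF assms] assms
      by (simp add: word_class_eq_iff)
  qed
  moreover have "?f ` ({..<4 * n} \<times> UNIV) = carrier (semidihedral_group n)"
    using sd_normal_form_exists[OF assms]
    by (fastforce simp: semidihedral_group_def presented_group_def image_iff word_class_eq_iff)
  ultimately have "card (carrier (semidihedral_group n)) = card ({..<4 * n} \<times> (UNIV :: bool set))"
    by (metis card_image)
  then show ?thesis by (simp add: order_def card_cartesian_product)
qed

end

theory Submission
  imports Defs
begin

text \<open>
  An element \<open>h\<close> outside \<open>\<langle>a\<rangle>\<close> satisfies \<open>h\<^sup>2 \<in> \<langle>a\<rangle>\<close> and \<open>h\<^sup>4 = e\<close>, which makes \<open>\<langle>h\<rangle>\<close> the only maximal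
  cyclic subgroup containing \<open>h\<close>. The neighbours of \<open>h\<close> then lie in \<open>\<langle>h\<rangle>\<close> and form a clique. Since
  \<open>\<langle>a\<rangle>\<close> is a clique too, every nonempty set of vertices contains a vertex whose neighbours within that
  set form a clique, and colouring greedily along such vertices uses no more colours than the clique
  number.
\<close>

section \<open>Perfection from simplicial vertices\<close>

text \<open>A proper colouring is injective on a clique, because any two distinct members are
  adjacent.\<close>

lemma card_clique_le:
  assumes "finite (verts \<Gamma>)" "clique \<Gamma> K" "colourable \<Gamma> k"
  shows "card K \<le> k"
proof -
  obtain c :: "'a \<Rightarrow> nat" where c: "c ` verts \<Gamma> \<subseteq> {..<k}"
      "\<forall>x\<in>verts \<Gamma>. \<forall>y\<in>verts \<Gamma>. {x, y} \<in> edges \<Gamma> \<longrightarrow> c x \<noteq> c y"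
    using assms(3) unfolding colourable_def by blast
  have K: "K \<subseteq> verts \<Gamma>" "\<forall>x\<in>K. \<forall>y\<in>K. x \<noteq> y \<longrightarrow> {x, y} \<in> edges \<Gamma>"
    using assms(2) unfolding clique_def by blast+
  have "inj_on c K" using c(2) K by (meson inj_onI subsetD)
  moreover have "c ` K \<subseteq> {..<k}" using c(1) K(1) by blast
  ultimately show ?thesis by (metis card_inj_on_le card_lessThan finite_lessThan)
qed

lemma finite_cliques: "finite (verts \<Gamma>) \<Longrightarrow> finite {K. clique \<Gamma> K}"
  by (rule finite_subset[of _ "Pow (verts \<Gamma>)"]) (auto simp: clique_def)

lemma card_le_clique_number: "finite (verts \<Gamma>) \<Longrightarrow> clique \<Gamma> K \<Longrightarrow> card K \<le> clique_number \<Gamma>"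
  unfolding clique_number_def by (rule Max_ge) (auto simp: finite_cliques)

text \<open>By \<open>card_clique_le\<close> the clique number bounds the size of every colour set
  from below, so a colouring that attains this bound is optimal.\<close>

lemma clique_number_eqI:
  assumes "finite (verts \<Gamma>)" "colourable \<Gamma> (clique_number \<Gamma>)"
  shows "clique_number \<Gamma> = chromatic_number \<Gamma>"
proof -
  have "clique_number \<Gamma> \<le> k" if "colourable \<Gamma> k" for k
  proof -
    \<comment> \<open>The empty clique keeps the set under \<open>Max\<close> nonempty.\<close>
    have "clique \<Gamma> {}" by (simp add: clique_def)
    then show ?thesis
      unfolding clique_number_def
      using card_clique_le[OF assms(1) _ that] finite_cliques[OF assms(1)]
      by (subst Max_le_iff) auto
  qed
  then show ?thesis
    unfolding chromatic_number_def using assms(2) by (metis Least_equality)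
qed

lemma clique_induced_subgraph_iff:
  "W \<subseteq> verts \<Gamma> \<Longrightarrow> clique (induced_subgraph \<Gamma> W) K \<longleftrightarrow> clique \<Gamma> K \<and> K \<subseteq> W"
  unfolding clique_def induced_subgraph_def by auto

text \<open>Induction on \<open>W\<close>: remove a vertex \<open>v\<close> whose neighbours in
  \<open>W\<close> form a clique, colour the rest, then restore \<open>v\<close>. Its neighbours
  together with \<open>v\<close> form a clique, so they are fewer than the available colours and one
  colour is free for \<open>v\<close>.\<close>

lemma colourable_clique_number:
  assumes "finite W" "W \<subseteq> verts \<Gamma>" and loopfree: "\<And>x. {x} \<notin> edges \<Gamma>"
    and simplicial: "\<And>U. U \<subseteq> W \<Longrightarrow> U \<noteq> {} \<Longrightarrow> \<exists>v\<in>U. clique \<Gamma> {u \<in> U. u = v \<or> {u, v} \<in> edges \<Gamma>}"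
  shows "colourable (induced_subgraph \<Gamma> W) (clique_number (induced_subgraph \<Gamma> W))"
  using assms(1,2) simplicial
proof (induction W rule: finite_psubset_induct)
  case (psubset W)
  let ?I = "induced_subgraph \<Gamma>"
  show ?case
  proof (cases "W = {}")
    case True
    then show ?thesis by (simp add: colourable_def induced_subgraph_def)
  next
    case False
    have fin: "finite (verts (?I U))" if "U \<subseteq> W" for U
      using that psubset.hyps by (auto simp: induced_subgraph_def intro: finite_subset)
    from False psubset.prems(2)[of W] obtain v
      where v: "v \<in> W" "clique \<Gamma> {u \<in> W. u = v \<or> {u, v} \<in> edges \<Gamma>}" by blast
    define N where "N = {u \<in> W. {u, v} \<in> edges \<Gamma>}"
    let ?U = "W - {v}"
    have N: "finite N" "v \<notin> N" "N \<subseteq> ?U"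
      using psubset.hyps loopfree[of v] by (auto simp: N_def)
    have "?U \<subset> W" using v(1) by blast
    then have "colourable (?I ?U) (clique_number (?I ?U))"
      using psubset.prems by (intro psubset.IH) auto
    then obtain c :: "'a \<Rightarrow> nat" where c: "c ` ?U \<subseteq> {..<clique_number (?I ?U)}"
        "\<forall>x\<in>?U. \<forall>y\<in>?U. {x, y} \<in> edges \<Gamma> \<longrightarrow> c x \<noteq> c y"
      unfolding colourable_def by (auto simp: induced_subgraph_def)
    \<comment> \<open>The old colouring may be kept: a clique of the smaller graph is still a clique
      of the larger one, so the supply of colours does not shrink.\<close>
    have "clique_number (?I ?U) \<le> clique_number (?I W)"
    proof -
      have "clique (?I W) K" if "clique (?I ?U) K" for K
        using that psubset.prems(1) clique_induced_subgraph_iff[of W] clique_induced_subgraph_iff[of ?U]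
        by blast
      then have "{K. clique (?I ?U) K} \<subseteq> {K. clique (?I W) K}" by blast
      moreover have "{} \<in> {K. clique (?I ?U) K}" by (simp add: clique_def)
      ultimately show ?thesis
        unfolding clique_number_def using finite_cliques[OF fin, of W]
        by (intro Max_mono image_mono) auto
    qed
    \<comment> \<open>Strict, since \<open>insert v N\<close> is a clique with one vertex more than
      \<open>N\<close>.\<close>
    moreover have "card N < clique_number (?I W)"
    proof -
      have "{u \<in> W. u = v \<or> {u, v} \<in> edges \<Gamma>} = insert v N" using v(1) by (auto simp: N_def)
      then have "clique (?I W) (insert v N)"
        using v psubset.prems(1) N by (subst clique_induced_subgraph_iff) auto
      from card_le_clique_number[OF fin this] N show ?thesis by simp
    qed
    moreover have "card (c ` N) \<le> card N" using N(1) by (rule card_image_le)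
    ultimately have le: "clique_number (?I ?U) \<le> clique_number (?I W)"
      and lt: "card (c ` N) < card {..<clique_number (?I W)}" by simp_all
    \<comment> \<open>Pigeonhole: the neighbours of \<open>v\<close> cannot exhaust the colours,
      which yields the colour \<open>d\<close> for \<open>v\<close>.\<close>
    from lt have "\<not> {..<clique_number (?I W)} \<subseteq> c ` N"
      using N(1) by (metis card_mono finite_imageI not_le)
    then obtain d where d: "d < clique_number (?I W)" "d \<notin> c ` N" by blast
    let ?c = "c(v := d)"
    have "?c ` W \<subseteq> {..<clique_number (?I W)}" using c(1) d(1) le by fastforce
    moreover have "?c x \<noteq> ?c y" if "x \<in> W" "y \<in> W" "{x, y} \<in> edges \<Gamma>" for x y
    proof -
      \<comment> \<open>Only edges at \<open>v\<close> can be affected by the recolouring, and their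
        other end lies in \<open>N\<close>, where \<open>d\<close> does not occur.\<close>
      have "x \<noteq> y" using that loopfree[of x] by auto
      moreover have "c x \<noteq> d" if "y = v" using that d(2) \<open>x \<in> W\<close> \<open>{x, y} \<in> edges \<Gamma>\<close>
        by (auto simp: N_def)
      moreover have "c y \<noteq> d" if "x = v" using that d(2) \<open>y \<in> W\<close> \<open>{x, y} \<in> edges \<Gamma>\<close>
        by (auto simp: N_def insert_commute)
      ultimately show ?thesis using c(2) that by auto
    qed
    ultimately show ?thesis
      unfolding colourable_def by (intro exI[of _ ?c]) (auto simp: induced_subgraph_def)
  qed
qed

text \<open>The last hypothesis ranges over all vertex sets, so every induced subgraph inherits
  it.\<close>

lemma perfect_graphI:
  assumes "finite (verts \<Gamma>)" "\<And>x. {x} \<notin> edges \<Gamma>"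
    and "\<And>U. U \<subseteq> verts \<Gamma> \<Longrightarrow> U \<noteq> {} \<Longrightarrow> \<exists>v\<in>U. clique \<Gamma> {u \<in> U. u = v \<or> {u, v} \<in> edges \<Gamma>}"
  shows "perfect_graph \<Gamma>"
  unfolding perfect_graph_def
proof (intro allI impI)
  fix W assume W: "W \<subseteq> verts \<Gamma>"
  then have "finite W" using assms(1) finite_subset by blast
  moreover have "colourable (induced_subgraph \<Gamma> W) (clique_number (induced_subgraph \<Gamma> W))"
    by (rule colourable_clique_number) (use \<open>finite W\<close> W assms in auto)
  ultimately show "clique_number (induced_subgraph \<Gamma> W) = chromatic_number (induced_subgraph \<Gamma> W)"
    by (intro clique_number_eqI) (simp_all add: induced_subgraph_def)
qed

section \<open>Enhanced power graphs\<close>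

context group
begin

text \<open>Replaces the cyclicity of a restricted group by \<open>generate\<close>, so that later
  arguments take place in \<open>G\<close> alone. Both directions rest on powers in a subgroup
  agreeing with powers in \<open>G\<close>.\<close>

lemma cyclic_subgroup_iff:
  "subgroup H G \<and> cyclic_group (G\<lparr>carrier := H\<rparr>) \<longleftrightarrow> (\<exists>x\<in>carrier G. H = generate G {x})"
proof -
  have range: "range (\<lambda>k::int. x [^]\<^bsub>G\<lparr>carrier := K\<rparr>\<^esub> k) = generate G {x}"
    if "subgroup K G" "x \<in> K" for x K
    using that generate_pow[of x] subgroup.mem_carrier[OF that] int_pow_consistent[OF that] by auto
  show ?thesis
  proof
    assume H: "subgroup H G \<and> cyclic_group (G\<lparr>carrier := H\<rparr>)"
    then interpret H: group "G\<lparr>carrier := H\<rparr>" by (simp add: subgroup_imp_group)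
    from H obtain x where "x \<in> H" "H = range (\<lambda>k::int. x [^]\<^bsub>G\<lparr>carrier := H\<rparr>\<^esub> k)"
      unfolding H.cyclic_group by auto
    then show "\<exists>x\<in>carrier G. H = generate G {x}"
      using H range subgroup.mem_carrier by metis
  next
    assume "\<exists>x\<in>carrier G. H = generate G {x}"
    then obtain x where x: "x \<in> carrier G" "H = generate G {x}" by blast
    then have H: "subgroup H G" by (simp add: generate_is_subgroup)
    then interpret H: group "G\<lparr>carrier := H\<rparr>" by (simp add: subgroup_imp_group)
    have "x \<in> H" using x generate.incl by fastforce
    then have "cyclic_group (G\<lparr>carrier := H\<rparr>)"
      unfolding H.cyclic_group using range[OF H] x by auto
    with H show "subgroup H G \<and> cyclic_group (G\<lparr>carrier := H\<rparr>)" by blast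
  qed
qed

lemma edge_enhanced_power_graph_iff:
  "{x, y} \<in> edges (enhanced_power_graph G) \<longleftrightarrow>
     x \<noteq> y \<and> (\<exists>g\<in>carrier G. x \<in> generate G {g} \<and> y \<in> generate G {g})"
proof -
  have "{x, y} \<in> edges (enhanced_power_graph G) \<longleftrightarrow> x \<noteq> y \<and> x \<in> carrier G \<and> y \<in> carrier G \<and>
      (\<exists>H. (subgroup H G \<and> cyclic_group (G\<lparr>carrier := H\<rparr>)) \<and> x \<in> H \<and> y \<in> H)"
    unfolding enhanced_power_graph_def by (auto simp: doubleton_eq_iff)
  moreover have "generate G {g} \<subseteq> carrier G" if "g \<in> carrier G" for g
    using that by (intro generate_incl) simp
  ultimately show ?thesis unfolding cyclic_subgroup_iff by blast
qed

lemma clique_enhanced_power_graph: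
  assumes "g \<in> carrier G" "K \<subseteq> generate G {g}"
  shows "clique (enhanced_power_graph G) K"
proof -
  have "K \<subseteq> verts (enhanced_power_graph G)"
    using assms generate_incl[of "{g}"] by (auto simp: enhanced_power_graph_def)
  then show ?thesis
    using assms unfolding clique_def edge_enhanced_power_graph_iff by blast
qed

text \<open>The assumption \<open>maximal\<close> says that any cyclic subgroup containing an
  element \<open>g\<close> outside \<open>generate G {a}\<close> is \<open>generate G {g}\<close>
  itself. Such a \<open>g\<close> is a suitable vertex of any \<open>U\<close> containing it; if
  \<open>U\<close> has none, all of \<open>U\<close> is a clique.\<close>

lemma perfect_enhanced_power_graphI:
  assumes "finite (carrier G)" "a \<in> carrier G"
    and maximal: "\<And>g h. g \<in> carrier G \<Longrightarrow> g \<notin> generate G {a} \<Longrightarrow> h \<in> carrier G \<Longrightarrow>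
      g \<in> generate G {h} \<Longrightarrow> h \<in> generate G {g}"
  shows "perfect_graph (enhanced_power_graph G)"
proof (rule perfect_graphI)
  have verts: "verts (enhanced_power_graph G) = carrier G" by (simp add: enhanced_power_graph_def)
  show "finite (verts (enhanced_power_graph G))" using assms(1) by (simp add: verts)
  show "{x} \<notin> edges (enhanced_power_graph G)" for x
    using edge_enhanced_power_graph_iff[of x x] by simp
  fix U assume "U \<subseteq> verts (enhanced_power_graph G)" "U \<noteq> {}"
  then have U: "U \<subseteq> carrier G" by (simp add: verts)
  show "\<exists>v\<in>U. clique (enhanced_power_graph G) {u \<in> U. u = v \<or> {u, v} \<in> edges (enhanced_power_graph G)}"
  proof (cases "U \<subseteq> generate G {a}")
    case True
    obtain v where "v \<in> U" using \<open>U \<noteq> {}\<close> by blast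
    moreover have "{u \<in> U. u = v \<or> {u, v} \<in> edges (enhanced_power_graph G)} \<subseteq> generate G {a}"
      using True by auto
    ultimately show ?thesis using clique_enhanced_power_graph[OF assms(2)] by blast
  next
    case False
    then obtain g where g: "g \<in> U" "g \<in> carrier G" "g \<notin> generate G {a}" using U by blast
    \<comment> \<open>An edge gives a cyclic subgroup \<open>generate G {h}\<close> containing both
      ends; maximality forces it into \<open>generate G {g}\<close>.\<close>
    have "u \<in> generate G {g}" if "{u, g} \<in> edges (enhanced_power_graph G)" for u
    proof -
      from that obtain h where h: "h \<in> carrier G" "u \<in> generate G {h}" "g \<in> generate G {h}"
        unfolding edge_enhanced_power_graph_iff by blast
      with g maximal have "h \<in> generate G {g}" by blast
      then have "generate G {h} \<subseteq> generate G {g}"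
        using g(2) by (intro generate_subgroup_incl generate_is_subgroup) auto
      then show ?thesis using h(2) by blast
    qed
    then have "{u \<in> U. u = g \<or> {u, g} \<in> edges (enhanced_power_graph G)} \<subseteq> generate G {g}"
      by (auto intro: generate.incl)
    then show ?thesis using clique_enhanced_power_graph[OF g(2)] g(1) by blast
  qed
qed

text \<open>Write \<open>g\<close> as the \<open>k\<close>-th power of \<open>h\<close>. An even
  \<open>k\<close> would put \<open>g\<close> into \<open>C\<close>, since the square of
  \<open>h\<close> lies there. So \<open>k\<close> is odd, \<open>k * k\<close> is 1 modulo 4, and
  the \<open>k\<close>-th power of \<open>g\<close> is \<open>h\<close>.\<close>

lemma generator_in_generate:
  assumes C: "subgroup C G" and h: "h \<in> carrier G" "g \<in> generate G {h}" "g \<notin> C"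
    and sq: "h \<notin> C \<Longrightarrow> h [^] (2::int) \<in> C" and four: "h \<notin> C \<Longrightarrow> h [^] (4::int) = \<one>"
  shows "h \<in> generate G {g}"
proof -
  obtain k :: int where k: "g = h [^] k" using h by (auto simp: generate_pow)
  \<comment> \<open>Otherwise its power \<open>g\<close> would lie in \<open>C\<close>; this unlocks
    \<open>sq\<close> and \<open>four\<close>.\<close>
  have "h \<notin> C" using C h k subgroup_int_pow_closed by blast
  have "odd k"
  proof
    assume "even k"
    then obtain m where "k = 2 * m" by blast
    then have "g = (h [^] (2::int)) [^] m" using k h(1) by (simp add: int_pow_pow)
    then show False using C sq[OF \<open>h \<notin> C\<close>] subgroup_int_pow_closed h(3) by blast
  qed
  then obtain m where "k = 2 * m + 1" by (elim oddE)
  then have "k * k = 4 * (m * m + m) + 1" by (simp add: algebra_simps)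
  then have "g [^] k = (h [^] (4::int)) [^] (m * m + m) \<otimes> h"
    using h(1) k by (simp add: int_pow_pow int_pow_mult)
  then have "g [^] k = h" using four[OF \<open>h \<notin> C\<close>] h(1) by simp
  moreover have "g \<in> carrier G" using k h(1) by simp
  ultimately show ?thesis by (auto simp: generate_pow)
qed

end

section \<open>The semidihedral group\<close>

text \<open>Moving the first \<open>b\<close> past the second block of \<open>a\<close>s multiplies
  the exponent of that block by \<open>2 * n - 1\<close>. The exponents then add up to
  \<open>2 * n * i\<close>, and the two letters \<open>b\<close> cancel.\<close>

lemma sd_reflection_square:
  fixes n i :: nat
  assumes "n > 0"
  defines "w \<equiv> sd_normal_form (i, True)"
  shows "word_eq (semidihedral_relations n) (w @ w) (replicate (2 * n * i) (Gen SD_a))"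
proof -
  let ?E = "word_eq (semidihedral_relations n)"
  let ?A = "\<lambda>k. replicate k (Gen SD_a)"
  \<comment> \<open>The truncated subtraction on \<open>nat\<close> is harmless because
    \<open>n\<close> is positive.\<close>
  have "i + (2 * n - 1) * i = (1 + (2 * n - 1)) * i" by (simp only: distrib_right mult_1)
  then have exponent: "i + (2 * n - 1) * i = 2 * n * i" using assms(1) by simp
  have bb: "?E [Gen SD_b, Gen SD_b] []"
    by (rule word_eq.relation) (simp add: semidihedral_relations_def numeral_2_eq_2)
  \<comment> \<open>The bracketing isolates the factor to which \<open>sd_b_a\<close>
    applies.\<close>
  have "?E (?A i @ (Gen SD_b # ?A i) @ [Gen SD_b]) (?A i @ (?A ((2 * n - 1) * i) @ [Gen SD_b]) @ [Gen SD_b])"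
    by (intro word_eq.cong word_eq.refl sd_b_a)
  then have "?E (w @ w) (?A (2 * n * i) @ [Gen SD_b, Gen SD_b])"
    unfolding exponent[symmetric] replicate_add by (simp add: w_def sd_normal_form_def)
  also have "?E \<dots> (?A (2 * n * i) @ [])" by (intro word_eq.cong word_eq.refl bb)
  finally (word_eq.trans) show ?thesis by simp
qed

theorem theorem3p33:
  fixes n :: nat
  assumes "n \<ge> 2"
  shows "perfect_graph (enhanced_power_graph (semidihedral_group n))"
proof -
  let ?G = "semidihedral_group n"
  let ?R = "semidihedral_relations n"
  let ?a = "word_class ?R [Gen SD_a]"
  interpret group ?G by (rule group_semidihedral_group)
  have n: "n > 0" using assms by simp
  have carrier: "carrier ?G = range (word_class ?R)"
    and one: "\<one>\<^bsub>?G\<^esub> = word_class ?R []"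
    by (simp_all add: semidihedral_group_def presented_group_def)
  have mult: "word_class ?R u \<otimes>\<^bsub>?G\<^esub> word_class ?R v = word_class ?R (u @ v)" for u v
    by (simp add: semidihedral_group_def mult_presented_group)
  have a: "?a \<in> carrier ?G" by (simp add: carrier)
  have "?a [^]\<^bsub>?G\<^esub> k = word_class ?R (replicate k (Gen SD_a))" for k :: nat
    by (induction k) (simp_all add: one mult replicate_append_same)
  then have powers: "word_class ?R (replicate k (Gen SD_a)) \<in> generate ?G {?a}" for k
    unfolding generate_pow[OF a] by (metis (mono_tags, lifting) UNIV_I int_pow_int mem_Collect_eq)
  \<comment> \<open>These are the two conditions \<open>sq\<close> and \<open>four\<close> of
    \<open>generator_in_generate\<close> for the subgroup generated by \<open>?a\<close>.\<close>
  have outside: "h [^]\<^bsub>?G\<^esub> (2::int) \<in> generate ?G {?a} \<and> h [^]\<^bsub>?G\<^esub> (4::int) = \<one>\<^bsub>?G\<^esub>"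
    if h: "h \<in> carrier ?G" "h \<notin> generate ?G {?a}" for h
  proof -
    obtain u where "h = word_class ?R u" using h by (auto simp: carrier)
    then obtain i j where ij: "h = word_class ?R (sd_normal_form (i, j))"
      using sd_normal_form_exists[OF n] word_class_eq_iff by metis
    \<comment> \<open>A normal form without \<open>b\<close> would be a power of
      \<open>?a\<close>.\<close>
    then have "j = True" using h(2) powers[of i] by (cases j) (auto simp: sd_normal_form_def)
    have "h [^]\<^bsub>?G\<^esub> (2::int) = h \<otimes>\<^bsub>?G\<^esub> h"
      using int_pow_mult[OF h(1), of 1 1] h(1) by simp
    also have "\<dots> = word_class ?R (replicate (2 * n * i) (Gen SD_a))"
      using sd_reflection_square[OF n, of i] by (simp add: ij mult word_class_eq_iff \<open>j = True\<close>)
    finally have sq: "h [^]\<^bsub>?G\<^esub> (2::int) = word_class ?R (replicate (2 * n * i) (Gen SD_a))" .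
    have "h [^]\<^bsub>?G\<^esub> (4::int) = h [^]\<^bsub>?G\<^esub> (2::int) \<otimes>\<^bsub>?G\<^esub> h [^]\<^bsub>?G\<^esub> (2::int)"
      using int_pow_mult[OF h(1), of 2 2] by simp
    \<comment> \<open>Doubling the exponent \<open>2 * n * i\<close> gives a multiple of
      \<open>4 * n\<close>, the exponent killed by the first defining relation.\<close>
    also have "\<dots> = word_class ?R (replicate (4 * n * i) (Gen SD_a))"
      unfolding sq mult replicate_add[symmetric] by (simp flip: mult_2 add: mult.assoc)
    also have "\<dots> = \<one>\<^bsub>?G\<^esub>"
      using sd_a_mod[of n "4 * n * i"] by (simp add: one word_class_eq_iff)
    finally show ?thesis using sq powers by simp
  qed
  \<comment> \<open>An infinite carrier would have \<open>card\<close> equal to 0, whereas the order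
    \<open>8 * n\<close> is positive.\<close>
  have "finite (carrier ?G)"
    using order_semidihedral_group[OF n] n by (intro card_ge_0_finite) (simp add: order_def)
  then show ?thesis
  proof (rule perfect_enhanced_power_graphI[OF _ a])
    fix g h assume gh: "g \<notin> generate ?G {?a}" "h \<in> carrier ?G" "g \<in> generate ?G {h}"
    have "subgroup (generate ?G {?a}) ?G" using a by (intro generate_is_subgroup) simp
    then show "h \<in> generate ?G {g}"
      by (rule generator_in_generate) (use gh outside[of h] in \<open>simp_all\<close>)
  qed
qed

end
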